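(* Let $S$ be the class of all increasing functions $f(x)$, $x\ge 0$, such that the shift inequality $$E f(a+Y)\le f\bigl(a+f^{-1}(E f(Y))\bigr)$$ holds for every number $a\ge 0$ and every random variable $Y\ge 0$. Then $S$ contains: (a) all exponential functions $f(x)=e^{\lambda x}$, $\lambda>0$; (b) all power functions $f(x)=x^m$, $m\ge 1$; (c) all increasing convex functions with concave derivatives.
   Context: "Increasing" means strictly increasing. $f^{-1}$ is the inverse of $f$ on its range; the functions in (a)–(c) are continuous and unbounded, so $f^{-1}$ is defined on $[f(0),\infty)$. If $E f(Y)=\infty$ the right-hand side is interpreted as $+\infty$, so the inequality is trivially true. *)

theory Defs
  imports "HOL-Probability.Probability"
begin

text \<open>
  Functions on the half-line are modelled as \<^typ>\<open>real \<Rightarrow> real\<close>, and only their values on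
  \<^term>\<open>{0::real..}\<close> are used. As \<^term>\<open>f\<close> is bounded below on the half-line, the only way an
  expectation below can fail to be a real number is to be plus infinity. Hence the inequality is
  void if the expectation of \<^term>\<open>f\<close> of \<^term>\<open>Y\<close> is infinite. If it is finite, the inequality
  says that the left-hand side is finite too (an integrability claim, since the Bochner integral is 0
  for non-integrable functions), that the inverse is defined at the expectation
  (since \<^const>\<open>inv_into\<close> is total), and that the real inequality holds.
\<close>

definition shift_inequality :: "'a measure \<Rightarrow> ('a \<Rightarrow> real) \<Rightarrow> (real \<Rightarrow> real) \<Rightarrow> real \<Rightarrow> bool" where
  "shift_inequality M Y f a \<longleftrightarrow>
     (integrable M (\<lambda>\<omega>. f (Y \<omega>)) \<longrightarrow>
        integrable M (\<lambda>\<omega>. f (a + Y \<omega>)) \<and>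
        (\<integral>\<omega>. f (Y \<omega>) \<partial>M) \<in> f ` {0..} \<and>
        (\<integral>\<omega>. f (a + Y \<omega>) \<partial>M) \<le> f (a + inv_into {0..} f (\<integral>\<omega>. f (Y \<omega>) \<partial>M)))"

text \<open>
  The type argument is the type of the sample points: a definition cannot quantify over
  types, so the probability spaces of all types are covered by leaving it a type variable.
\<close>

definition shift_class :: "'a itself \<Rightarrow> (real \<Rightarrow> real) set" where
  "shift_class (_ :: 'a itself) =
     {f. strict_mono_on {0..} f \<and>
         (\<forall>a \<ge> 0. \<forall>(M :: 'a measure) Y.
            prob_space M \<longrightarrow> Y \<in> borel_measurable M \<longrightarrow> (\<forall>\<omega> \<in> space M. 0 \<le> Y \<omega>) \<longrightarrow>
            shift_inequality M Y f a)}"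

end

theory Submission
  imports Defs "HOL-Real_Asymp.Real_Asymp"
begin

text \<open>
  Suppose that \<^term>\<open>f\<close> has a positive derivative \<^term>\<open>h\<close> for which the ratio
  \<^term>\<open>h (a + x) / h x\<close> is nonincreasing in \<^term>\<open>x\<close> (which is log-concavity of \<^term>\<open>h\<close>).
  Then the function taking \<^term>\<open>f x\<close> to \<^term>\<open>f (a + x)\<close> is concave, and the shift inequality is
  Jensen's inequality for it. It is enough to integrate its tangent inequality at
  the point \<^term>\<open>c\<close> with \<^term>\<open>f c = (\<integral>\<omega>. f (Y \<omega>) \<partial>M)\<close>. If \<^term>\<open>c = (0::real)\<close>, there may be no tangent, but
  then \<^term>\<open>Y\<close> vanishes almost everywhere. All three families have log-concave derivatives.
\<close>

text \<open>As \<open>v + w = u + z\<close>, the points \<open>v\<close> and \<open>w\<close> divide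
  the segment from \<open>u\<close> to \<open>z\<close> in mirrored proportions \<open>t\<close> and
  \<open>1 - t\<close>. Concavity bounds \<open>h v\<close> and \<open>h w\<close> below by the
  matching means of \<open>h u\<close> and \<open>h z\<close>, and the product of these means
  exceeds \<open>h u * h z\<close> by \<open>t * (1 - t) * (h u - h z)\<^sup>2\<close>. This is how
  nonnegativity and concavity yield log-concavity.\<close>

lemma concave_on_mult_le:
  fixes h :: "real \<Rightarrow> real"
  assumes conc: "concave_on S h" and u: "u \<in> S" "0 \<le> h u" and z: "z \<in> S" "0 \<le> h z"
    and v: "u \<le> v" "v \<le> z" and sum: "v + w = u + z"
  shows "h u * h z \<le> h v * h w"
proof (cases "u = z")
  case True
  with v sum have "v = u" "w = u" "z = u" by auto
  then show ?thesis by simp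
next
  case False
  define t where "t = (v - u) / (z - u)"
  have uz: "u < z" using False v by simp
  have t: "0 \<le> t" "t \<le> 1" using uz v by (auto simp: t_def)
  have "t * (z - u) = v - u" using uz by (simp add: t_def)
  then have vw: "v = (1 - t) * u + t * z" "w = t * u + (1 - t) * z"
    using sum by (auto simp: algebra_simps)
  have hv: "(1 - t) * h u + t * h z \<le> h v"
    using concave_onD[OF conc, of t u z] t u z vw by simp
  have hw: "t * h u + (1 - t) * h z \<le> h w"
    using concave_onD[OF conc, of "1 - t" u z] t u z vw by simp
  have "h u * h z \<le> h u * h z + t * (1 - t) * (h u - h z)\<^sup>2"
    using t by simp
  also have "\<dots> = ((1 - t) * h u + t * h z) * (t * h u + (1 - t) * h z)"
    by (simp add: algebra_simps power2_eq_square)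
  also have "\<dots> \<le> h v * h w"
    using hv hw t u z by (intro mult_mono) (auto intro!: add_nonneg_nonneg order_trans[OF _ hv])
  finally show ?thesis .
qed

text \<open>Let \<open>k\<close> be the slope at \<open>f c\<close> of the map taking
  \<open>f x\<close> to \<open>f (a + x)\<close>. By \<open>ratio\<close>, the derivative
  \<open>h (a + x) - k * h x\<close> of \<open>\<phi>\<close> is nonnegative before \<open>c\<close>
  and nonpositive after it, so \<open>\<phi>\<close> is largest at \<open>c\<close>.\<close>

lemma shift_tangent_inequality:
  fixes f h :: "real \<Rightarrow> real"
  assumes cont: "continuous_on {0..} f"
    and deriv: "\<And>x. 0 < x \<Longrightarrow> (f has_real_derivative h x) (at x)"
    and pos: "\<And>x. 0 < x \<Longrightarrow> 0 < h x"
    and ratio: "\<And>x y. 0 < x \<Longrightarrow> x \<le> y \<Longrightarrow> h (a + y) * h x \<le> h (a + x) * h y"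
    and a: "0 \<le> a" and c: "0 < c" and y: "0 \<le> y"
  shows "f (a + y) \<le> f (a + c) + h (a + c) / h c * (f y - f c)"
proof -
  define k where "k = h (a + c) / h c"
  define \<phi> where "\<phi> x = f (a + x) - k * f x" for x
  have shift: "continuous_on {0..} (\<lambda>x. f (a + x))"
    by (rule continuous_on_compose2[OF cont]) (use a in \<open>auto intro!: continuous_intros\<close>)
  have cont_\<phi>: "continuous_on {p..q} \<phi>" if "0 \<le> p" for p q
    unfolding \<phi>_def
    using shift cont that by (intro continuous_intros) (auto elim!: continuous_on_subset)
  have deriv_\<phi>: "(\<phi> has_real_derivative h (a + x) - k * h x) (at x)" if "0 < x" for x
  proof -
    have "((\<lambda>x. f (a + x)) has_real_derivative h (a + x)) (at x)"
      using DERIV_at_within_shift[of f "h (a + x)" a x UNIV] deriv[of "a + x"] that a by simp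
    then show ?thesis
      unfolding \<phi>_def using deriv[OF that] by (intro DERIV_diff DERIV_cmult)
  qed
  have "\<phi> y \<le> \<phi> c"
  proof (cases "y \<le> c")
    case True
    show ?thesis
    \<comment> \<open>The open version asks for derivatives only strictly between \<open>y\<close>
      and \<open>c\<close>, which admits \<open>y = 0\<close>, where only continuity is
      assumed.\<close>
    proof (rule DERIV_nonneg_imp_increasing_open[OF True _ cont_\<phi>[OF y]])
      fix x assume x: "y < x" "x < c"
      then have "0 \<le> h (a + x) - k * h x"
        using ratio[of x c] pos[OF c] y by (simp add: k_def field_simps)
      then show "\<exists>d. (\<phi> has_real_derivative d) (at x) \<and> 0 \<le> d"
        using deriv_\<phi>[of x] x y by auto
    qed
  next
    case False
    then have cy: "c \<le> y" by simp
    show ?thesis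
    proof (rule DERIV_nonpos_imp_decreasing_open[OF cy _ cont_\<phi>])
      fix x assume x: "c < x" "x < y"
      then have "h (a + x) - k * h x \<le> 0"
        using ratio[of c x] pos[OF c] c by (simp add: k_def field_simps)
      then show "\<exists>d. (\<phi> has_real_derivative d) (at x) \<and> d \<le> 0"
        using deriv_\<phi>[of x] x c by auto
    qed (use c in simp)
  qed
  then show ?thesis
    unfolding k_def[symmetric] by (simp add: \<phi>_def algebra_simps)
qed

text \<open>By the intermediate value theorem. It will put the mean of
  \<open>f (Y \<omega>)\<close>, which is at least \<open>f 0\<close>, in the range of
  \<open>f\<close>.\<close>

lemma atLeast_subset_image_unbounded:
  fixes f :: "real \<Rightarrow> real"
  assumes cont: "continuous_on {0..} f" and unb: "filterlim f at_top at_top"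
  shows "{f 0..} \<subseteq> f ` {0..}"
proof
  fix v assume v: "v \<in> {f 0..}"
  have "eventually (\<lambda>x. 0 \<le> x \<and> v \<le> f x) at_top"
    using unb eventually_ge_at_top[of "0::real"]
    by (auto simp: filterlim_at_top intro: eventually_conj)
  then obtain b where b: "0 \<le> b" "v \<le> f b"
    by (auto dest: eventually_happens)
  have "\<exists>x. 0 \<le> x \<and> x \<le> b \<and> f x = v"
    using v b by (intro IVT') (auto intro: continuous_on_subset[OF cont])
  then show "v \<in> f ` {0..}" by auto
qed

text \<open>The common criterion for the three families; \<open>ratio\<close> is the monotonicity of
  \<open>h (a + x) / h x\<close> with denominators cleared. The conditions on \<open>h\<close> avoid
  0, where \<open>f\<close> may have no two-sided derivative.\<close>

lemma shift_class_ratioI: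
  fixes f h :: "real \<Rightarrow> real"
  assumes mono: "strict_mono_on {0..} f"
    and cont: "continuous_on {0..} f"
    and unb: "filterlim f at_top at_top"
    and deriv: "\<And>x. 0 < x \<Longrightarrow> (f has_real_derivative h x) (at x)"
    and pos: "\<And>x. 0 < x \<Longrightarrow> 0 < h x"
    and ratio: "\<And>a x y. 0 \<le> a \<Longrightarrow> 0 < x \<Longrightarrow> x \<le> y \<Longrightarrow> h (a + y) * h x \<le> h (a + x) * h y"
  shows "f \<in> shift_class TYPE('a)"
proof -
  have "shift_inequality M Y f a"
    if a: "0 \<le> a" and "prob_space M" and Y: "Y \<in> borel_measurable M"
      and Y0: "\<forall>\<omega>\<in>space M. 0 \<le> Y \<omega>"
    for a and M :: "'a measure" and Y
    unfolding shift_inequality_def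
  proof (rule impI)
    assume int: "integrable M (\<lambda>\<omega>. f (Y \<omega>))"
    interpret prob_space M by fact
    have inj: "inj_on f {0..}" using mono by (rule strict_mono_on_imp_inj_on)
    have f_le: "f x \<le> f y" if "0 \<le> x" "x \<le> y" for x y
      using strict_mono_onD[OF mono, of x y] that by (cases "x = y") auto
    have "f 0 \<le> expectation (\<lambda>\<omega>. f (Y \<omega>))"
      using Y0 int by (intro integral_ge_const) (auto intro!: f_le)
    then have ran: "expectation (\<lambda>\<omega>. f (Y \<omega>)) \<in> f ` {0..}"
      using atLeast_subset_image_unbounded[OF cont unb] by auto
    then obtain c where c: "0 \<le> c" "expectation (\<lambda>\<omega>. f (Y \<omega>)) = f c" by auto
    have inv: "inv_into {0..} f (f c) = c"
      using inj c by (simp add: inv_into_f_f)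
    \<comment> \<open>Nothing is known about \<open>f\<close> on negative arguments. Composing with
      \<open>max 0\<close> gives a continuous, hence Borel, function on the whole line that agrees
      with \<open>f\<close> at all values of \<open>a + Y \<omega>\<close>.\<close>
    have "continuous_on UNIV (\<lambda>x. f (max 0 x))"
      by (rule continuous_on_compose2[OF cont]) (auto intro!: continuous_intros)
    then have "(\<lambda>x. f (max 0 x)) \<in> borel_measurable borel"
      by (rule borel_measurable_continuous_onI)
    then have "(\<lambda>\<omega>. f (max 0 (a + Y \<omega>))) \<in> borel_measurable M"
      using Y by (auto intro: measurable_compose[rotated])
    then have meas: "(\<lambda>\<omega>. f (a + Y \<omega>)) \<in> borel_measurable M"
      using a Y0 by (subst measurable_cong[where g = "\<lambda>\<omega>. f (max 0 (a + Y \<omega>))"]) auto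
    have "integrable M (\<lambda>\<omega>. f (a + Y \<omega>)) \<and> expectation (\<lambda>\<omega>. f (a + Y \<omega>)) \<le> f (a + c)"
    proof (cases "c = 0")
      case True
      have int0: "integrable M (\<lambda>\<omega>. f (Y \<omega>) - f 0)" using int by simp
      have "(\<integral>\<omega>. f (Y \<omega>) - f 0 \<partial>M) = 0"
        using int c True by (simp add: prob_space)
      then have "AE \<omega> in M. f (Y \<omega>) - f 0 = 0"
        using integral_nonneg_eq_0_iff_AE[OF int0] Y0 f_le by auto
      then have AE: "AE \<omega> in M. f (a + Y \<omega>) = f a"
      proof (rule AE_mp, intro AE_I2 impI)
        fix \<omega> assume "\<omega> \<in> space M" "f (Y \<omega>) - f 0 = 0"
        then have "Y \<omega> = 0" using inj_onD[OF inj, of "Y \<omega>" 0] Y0 by auto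
        then show "f (a + Y \<omega>) = f a" by simp
      qed
      have "integrable M (\<lambda>\<omega>. f (a + Y \<omega>))"
        using integrable_cong_AE[OF meas _ AE] by simp
      moreover have "expectation (\<lambda>\<omega>. f (a + Y \<omega>)) = f a"
        using integral_cong_AE[OF meas _ AE] by (simp add: prob_space)
      ultimately show ?thesis using True by simp
    next
      case False
      define k where "k = h (a + c) / h c"
      \<comment> \<open>The tangent bound is affine in \<open>f (Y \<omega>)\<close>: it inherits
        integrability, and its mean is \<open>f (a + c)\<close> because
        \<open>f (Y \<omega>)\<close> has mean \<open>f c\<close>.\<close>
      define u where "u \<omega> = f (a + c) + k * (f (Y \<omega>) - f c)" for \<omega>
      have le: "f (a + Y \<omega>) \<le> u \<omega>" if "\<omega> \<in> space M" for \<omega>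
        unfolding u_def k_def
        using False c a Y0 that ratio[OF a]
        by (intro shift_tangent_inequality[OF cont deriv pos]) auto
      have intu: "integrable M u"
        unfolding u_def using int by simp
      have intf: "integrable M (\<lambda>\<omega>. f (a + Y \<omega>))"
      proof (rule Bochner_Integration.integrable_bound)
        \<comment> \<open>Since \<open>f (a + Y \<omega>)\<close> lies between \<open>f 0\<close>
          and \<open>u \<omega>\<close>, this sum dominates its absolute value.\<close>
        show "integrable M (\<lambda>\<omega>. \<bar>u \<omega>\<bar> + \<bar>f 0\<bar>)" using intu by simp
        have "\<bar>f (a + Y \<omega>)\<bar> \<le> \<bar>u \<omega>\<bar> + \<bar>f 0\<bar>" if "\<omega> \<in> space M" for \<omega>
        proof -
          have "f 0 \<le> f (a + Y \<omega>)" using f_le[of 0 "a + Y \<omega>"] a Y0 that by simp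
          then show ?thesis using le[OF that] by linarith
        qed
        then show "AE \<omega> in M. norm (f (a + Y \<omega>)) \<le> norm (\<bar>u \<omega>\<bar> + \<bar>f 0\<bar>)"
          by (auto intro!: AE_I2)
      qed (fact meas)
      then have "expectation (\<lambda>\<omega>. f (a + Y \<omega>)) \<le> expectation u"
        using intu le by (intro integral_mono) auto
      also have "expectation u = f (a + c)"
        unfolding u_def using int c by (simp add: prob_space)
      finally show ?thesis using intf by simp
    qed
    then show "integrable M (\<lambda>\<omega>. f (a + Y \<omega>)) \<and>
        expectation (\<lambda>\<omega>. f (Y \<omega>)) \<in> f ` {0..} \<and>
        expectation (\<lambda>\<omega>. f (a + Y \<omega>)) \<le> f (a + inv_into {0..} f (expectation (\<lambda>\<omega>. f (Y \<omega>))))"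
      using ran c inv by simp
  qed
  then show ?thesis
    using mono by (auto simp: shift_class_def)
qed

text \<open>The ratio of derivatives is the constant \<open>exp (l * a)\<close>, so the ratio
  condition holds with equality.\<close>

lemma exp_in_shift_class:
  fixes l :: real
  assumes "0 < l"
  shows "(\<lambda>x. exp (l * x)) \<in> shift_class TYPE('a)"
proof (rule shift_class_ratioI[where h = "\<lambda>x. l * exp (l * x)"])
  show "filterlim (\<lambda>x. exp (l * x)) at_top at_top"
    using assms by real_asymp
  show "strict_mono_on {0..} (\<lambda>x. exp (l * x))"
    using assms by (auto intro!: strict_mono_onI)
  show "continuous_on {0..} (\<lambda>x. exp (l * x))"
    by (intro continuous_intros)
  show "((\<lambda>x. exp (l * x)) has_real_derivative l * exp (l * x)) (at x)" for x
    by (auto intro!: derivative_eq_intros)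
  show "l * exp (l * (a + y)) * (l * exp (l * x)) \<le> l * exp (l * (a + x)) * (l * exp (l * y))"
    for a x y
    by (simp add: distrib_left exp_add)
qed (use assms in simp)

text \<open>The ratio of derivatives is \<open>(1 + a / x) powr (m - 1)\<close>, nonincreasing in
  \<open>x\<close> because \<open>m - 1\<close> is nonnegative.\<close>

lemma powr_in_shift_class:
  fixes m :: real
  assumes "1 \<le> m"
  shows "(\<lambda>x. x powr m) \<in> shift_class TYPE('a)"
proof (rule shift_class_ratioI[where h = "\<lambda>x. m * x powr (m - 1)"])
  show "filterlim (\<lambda>x. x powr m) at_top at_top"
    using assms by real_asymp
  show "strict_mono_on {0..} (\<lambda>x. x powr m)"
    using assms by (auto intro!: strict_mono_onI powr_less_mono2)
  show "continuous_on {0..} (\<lambda>x. x powr m)"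
    using assms by (intro continuous_on_powr' continuous_intros) auto
  show "((\<lambda>x. x powr m) has_real_derivative m * x powr (m - 1)) (at x)" if "0 < x" for x
    using that by (rule has_real_derivative_powr)
  show "0 < m * x powr (m - 1)" if "0 < x" for x
    using that assms by simp
  show "m * (a + y) powr (m - 1) * (m * x powr (m - 1)) \<le>
      m * (a + x) powr (m - 1) * (m * y powr (m - 1))"
    if "0 \<le> a" "0 < x" "x \<le> y" for a x y
  proof -
    have "(a + y) * x \<le> (a + x) * y"
      using that by (simp add: algebra_simps mult_left_mono)
    then have "((a + y) * x) powr (m - 1) \<le> ((a + x) * y) powr (m - 1)"
      using that assms by (intro powr_mono2) auto
    then have "m * m * ((a + y) * x) powr (m - 1) \<le> m * m * ((a + x) * y) powr (m - 1)"
      by (intro mult_left_mono) auto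
    then show ?thesis
      using that by (simp add: powr_mult mult_ac)
  qed
qed

text \<open>The derivative is positive and concave, hence log-concave. Convexity supplies the rest:
  tangents give positivity and unboundedness, a chord gives continuity at 0.\<close>

lemma convex_concave_deriv_in_shift_class:
  fixes f :: "real \<Rightarrow> real"
  assumes mono: "strict_mono_on {0..} f" and conv: "convex_on {0..} f"
    and diff: "\<And>x. 0 < x \<Longrightarrow> f differentiable at x" and conc: "concave_on {0<..} (deriv f)"
  shows "f \<in> shift_class TYPE('a)"
proof (rule shift_class_ratioI[where h = "deriv f"])
  show deriv: "(f has_real_derivative deriv f x) (at x)" if "0 < x" for x
    using diff that by (simp add: DERIV_deriv_iff_real_differentiable)
  have tangent: "deriv f x * (y - x) \<le> f y - f x" if "0 < x" "0 \<le> y" for x y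
    using convex_on_imp_above_tangent[OF conv, of x y "deriv f x"] that
      has_field_derivative_at_within[OF deriv] by (auto simp: interior_real_atLeast)
  show pos: "0 < deriv f x" if "0 < x" for x
  proof -
    \<comment> \<open>The tangent at \<open>x\<close>, evaluated at 0, has to lie below
      \<open>f 0\<close>, which forces a positive slope.\<close>
    have "f 0 < f x" using strict_mono_onD[OF mono, of 0 x] that by simp
    then have "0 < deriv f x * x" using tangent[of x 0] that by simp
    then show ?thesis using that by (simp add: zero_less_mult_iff)
  qed
  \<comment> \<open>The tangent at 1 is a line of positive slope lying below
    \<open>f\<close>.\<close>
  have "filterlim (\<lambda>x. b + k * (x - 1)) at_top at_top" if "0 < k" for b k :: real
    using that by real_asymp
  from this[OF pos[OF zero_less_one], of "f 1"] show "filterlim f at_top at_top"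
  proof (rule filterlim_at_top_mono)
    show "eventually (\<lambda>x. f 1 + deriv f 1 * (x - 1) \<le> f x) at_top"
      using eventually_ge_at_top[of 0]
      by eventually_elim (use tangent[of 1] in \<open>auto simp: algebra_simps\<close>)
  qed
  \<comment> \<open>Differentiability is given only at positive points, so continuity at 0 needs its
    own argument: near 0, \<open>f\<close> is squeezed between \<open>f 0\<close> and the chord from
    0 to 1.\<close>
  have lim0: "(f \<longlongrightarrow> f 0) (at_right 0)"
  proof (rule real_tendsto_sandwich)
    show "eventually (\<lambda>x. f 0 \<le> f x) (at_right 0)"
      using eventually_at_right_less[of 0]
      by eventually_elim (use strict_mono_onD[OF mono, of 0] in force)
    show "eventually (\<lambda>x. f x \<le> (1 - x) * f 0 + x * f 1) (at_right 0)"
      using eventually_at_right_real[of 0 1, OF zero_less_one]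
      by eventually_elim (use convex_onD[OF conv, of _ 0 1] in auto)
    have "((\<lambda>x. (1 - x) * f 0 + x * f 1) \<longlongrightarrow> (1 - 0) * f 0 + 0 * f 1) (at_right 0)"
      by (intro tendsto_intros)
    then show "((\<lambda>x. (1 - x) * f 0 + x * f 1) \<longlongrightarrow> f 0) (at_right 0)" by simp
  qed simp
  have "continuous (at x within {0..}) f" if "0 \<le> x" for x
  proof (cases "x = 0")
    case True
    then show ?thesis
      using lim0 by (simp add: continuous_within at_within_Ici_at_right)
  next
    case False
    then show ?thesis
      using that DERIV_isCont[OF deriv, of x] by (simp add: continuous_at_imp_continuous_at_within)
  qed
  then show "continuous_on {0..} f"
    by (auto simp: continuous_on_eq_continuous_within)
  show "deriv f (a + y) * deriv f x \<le> deriv f (a + x) * deriv f y"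
    if "0 \<le> a" "0 < x" "x \<le> y" for a x y
  proof -
    \<comment> \<open>Here \<open>x\<close> and \<open>a + y\<close> are the outer points,
      \<open>a + x\<close> and \<open>y\<close> the inner ones; both pairs have the same
      sum.\<close>
    have "deriv f x * deriv f (a + y) \<le> deriv f (a + x) * deriv f y"
      using that pos[of x] pos[of "a + y"] by (intro concave_on_mult_le[OF conc]) auto
    then show ?thesis by (simp only: mult.commute)
  qed
qed (fact mono)

theorem lemma2:
  shows "(\<forall>l::real. l > 0 \<longrightarrow> (\<lambda>x. exp (l * x)) \<in> shift_class TYPE('a)) \<and>
         (\<forall>m::real. m \<ge> 1 \<longrightarrow> (\<lambda>x. x powr m) \<in> shift_class TYPE('a)) \<and>
         (\<forall>f::real \<Rightarrow> real.
            strict_mono_on {0..} f \<longrightarrow> convex_on {0..} f \<longrightarrow>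
            (\<forall>x > 0. f differentiable at x) \<longrightarrow> concave_on {0<..} (deriv f) \<longrightarrow>
            f \<in> shift_class TYPE('a))"
  by (intro conjI allI impI exp_in_shift_class powr_in_shift_class
      convex_concave_deriv_in_shift_class) auto

end
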